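(* Let $(M,g)$ be an $n$-dimensional Riemannian manifold, $n\geq 3$, and let $(V,\lambda)$ define an almost Riemann soliton on $(M,g)$ with concircular potential vector field $V$, i.e. $\nabla V=aI$ with $a$ a smooth function on $M$. Let $\theta$ be the $g$-dual $1$-form of $V$. Then: i) $M$ is Ricci symmetric (i.e. $\nabla\operatorname{Ric}=0$) if and only if $d\lambda=2\,da$; ii) the Ricci tensor field $\operatorname{Ric}$ is $\theta$-recurrent (i.e. $\nabla\operatorname{Ric}=\theta\otimes\operatorname{Ric}$) if and only if $\operatorname{grad}(\lambda-2a)=(\lambda-2a)V$; iii) $\operatorname{Ric}$ is a Codazzi tensor field (i.e. $(\nabla_X\operatorname{Ric})(Y,Z)=(\nabla_Y\operatorname{Ric})(X,Z)$ for any $X,Y,Z\in\mathfrak{X}(M)$) if and only if $d(\lambda-2a)\otimes I=I\otimes d(\lambda-2a)$; iv) if $M$ has cyclic Ricci tensor (i.e. $(\nabla_X\operatorname{Ric})(Y,Z)+(\nabla_Y\operatorname{Ric})(Z,X)+(\nabla_Z\operatorname{Ric})(X,Y)=0$ for any $X,Y,Z\in\mathfrak{X}(M)$), then $$\operatorname{grad}(\lambda-2a)=-2V(\lambda-2a)\frac{V}{|V|^2}.$$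
   Context: Conventions: for $(0,2)$-tensor fields, $(T_1\odot T_2)(X,Y,Z,W)=T_1(X,W)T_2(Y,Z)+T_1(Y,Z)T_2(X,W)-T_1(X,Z)T_2(Y,W)-T_1(Y,W)T_2(X,Z)$ (Kulkarni-Nomizu product). $\nabla$ is the Levi-Civita connection, $R(X,Y)Z=\nabla_X\nabla_YZ-\nabla_Y\nabla_XZ-\nabla_{[X,Y]}Z$, $R(X,Y,Z,W)=g(R(X,Y)Z,W)$, and $\operatorname{Ric}(Y,Z)$ is the trace of $X\mapsto R(X,Y)Z$. $G:=\frac12 g\odot g$. For a non-vanishing (nowhere zero) smooth vector field $V$ and a smooth function $\lambda$ on $M$, $(V,\lambda)$ defines an almost Riemann soliton (with potential vector field $V$) if $\frac12(\pounds_Vg)\odot g+R=\lambda G$, where $\pounds_V$ is the Lie derivative. $I$ is the identity endomorphism on vector fields; $\nabla V=aI$ means $\nabla_XV=aX$ for all $X$. $\theta(X)=g(X,V)$, and $\theta\otimes\operatorname{Ric}$ means $(\nabla_X\operatorname{Ric})(Y,Z)=\theta(X)\operatorname{Ric}(Y,Z)$ in ii). For a function $h$, $(dh\otimes I)(X,Y)=X(h)Y$ and $(I\otimes dh)(X,Y)=Y(h)X$. $\mathfrak{X}(M)$ is the space of smooth vector fields on $M$. *)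

theory Defs
  imports "HOL-Analysis.Analysis"
begin

section \<open>Smooth maps between normed spaces\<close>

text \<open>
  \<open>k\<close>-fold continuous differentiability on an open set \<open>S\<close>, the derivatives being taken one
  direction at a time; in finite dimension this is the usual class \<open>C\<^sup>k\<close>.
\<close>

primrec Ck_on :: "nat \<Rightarrow> 'a::real_normed_vector set \<Rightarrow> ('a \<Rightarrow> 'b::real_normed_vector) \<Rightarrow> bool" where
  "Ck_on 0 S f \<longleftrightarrow> continuous_on S f"
| "Ck_on (Suc k) S f \<longleftrightarrow>
     (\<forall>x\<in>S. f differentiable (at x)) \<and> (\<forall>v. Ck_on k S (\<lambda>x. frechet_derivative f (at x) v))"

definition smooth_on :: "'a::real_normed_vector set \<Rightarrow> ('a \<Rightarrow> 'b::real_normed_vector) \<Rightarrow> bool" where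
  "smooth_on S f \<longleftrightarrow> (\<forall>k. Ck_on k S f)"


section \<open>Smooth manifolds\<close>

text \<open>
  The manifold is a whole Hausdorff, second countable type \<open>'m\<close>; its dimension is \<open>CARD('n)\<close>.
  A chart is a pair of its domain and the coordinate map, whose values outside the domain
  are irrelevant. The atlas need not be maximal.
\<close>

type_synonym ('m, 'n) chart = "'m set \<times> ('m \<Rightarrow> real ^ 'n)"

definition chart_inv :: "('m, 'n) chart \<Rightarrow> real ^ 'n \<Rightarrow> 'm" where
  "chart_inv c = inv_into (fst c) (snd c)"

definition is_chart :: "('m::topological_space, 'n::finite) chart \<Rightarrow> bool" where
  "is_chart c \<longleftrightarrow> open (fst c) \<and> open (snd c ` fst c) \<and>
     homeomorphism (fst c) (snd c ` fst c) (snd c) (chart_inv c)"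

definition smooth_atlas ::
    "('m::{t2_space, second_countable_topology}, 'n::finite) chart set \<Rightarrow> bool" where
  "smooth_atlas A \<longleftrightarrow>
     (\<forall>c\<in>A. is_chart c) \<and> (\<Union>c\<in>A. fst c) = UNIV \<and>
     (\<forall>c\<in>A. \<forall>d\<in>A. smooth_on (snd c ` (fst c \<inter> fst d)) (snd d \<circ> chart_inv c))"

definition smooth_fun ::
    "('m::{t2_space, second_countable_topology}, 'n::finite) chart set \<Rightarrow> ('m \<Rightarrow> real) \<Rightarrow> bool" where
  "smooth_fun A f \<longleftrightarrow> (\<forall>c\<in>A. smooth_on (snd c ` fst c) (f \<circ> chart_inv c))"

text \<open>
  Every point \<open>p\<close> gets one chart of the atlas around it. The tangent space at \<open>p\<close> is \<open>real ^ 'n\<close>,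
  a tangent vector being given by its components in that chart. Hence a (not necessarily
  continuous) vector field is a function \<open>'m \<Rightarrow> real ^ 'n\<close>; components in any other chart are
  obtained by the derivative of the transition map, and smoothness of a vector field means
  smoothness of its components in every chart.
\<close>

definition chart_at :: "('m, 'n) chart set \<Rightarrow> 'm \<Rightarrow> ('m, 'n) chart" where
  "chart_at A p = (SOME c. c \<in> A \<and> p \<in> fst c)"

definition components ::
    "('m, 'n::finite) chart set \<Rightarrow> ('m, 'n) chart \<Rightarrow> 'm \<Rightarrow> real ^ 'n \<Rightarrow> real ^ 'n" where
  "components A c p v =
     frechet_derivative (snd c \<circ> chart_inv (chart_at A p)) (at (snd (chart_at A p) p)) v"

definition vector_fields ::
    "('m::{t2_space, second_countable_topology}, 'n::finite) chart set \<Rightarrow> ('m \<Rightarrow> real ^ 'n) set" where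
  "vector_fields A =
     {X. \<forall>c\<in>A. smooth_on (snd c ` fst c)
                (\<lambda>x. components A c (chart_inv c x) (X (chart_inv c x)))}"

definition differential ::
    "('m, 'n::finite) chart set \<Rightarrow> ('m \<Rightarrow> real) \<Rightarrow> 'm \<Rightarrow> real ^ 'n \<Rightarrow> real" where
  "differential A f p v =
     frechet_derivative (f \<circ> chart_inv (chart_at A p)) (at (snd (chart_at A p) p)) v"

text \<open>The derivative \<open>X(f)\<close> of a function along a vector field.\<close>

definition along ::
    "('m, 'n::finite) chart set \<Rightarrow> ('m \<Rightarrow> real ^ 'n) \<Rightarrow> ('m \<Rightarrow> real) \<Rightarrow> 'm \<Rightarrow> real" where
  "along A X f p = differential A f p (X p)"

text \<open>\<open>[X,Y]\<close> is the vector field acting on smooth functions as \<open>f \<mapsto> X(Y(f)) - Y(X(f))\<close>.\<close>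

definition lie_bracket ::
    "('m::{t2_space, second_countable_topology}, 'n::finite) chart set \<Rightarrow>
      ('m \<Rightarrow> real ^ 'n) \<Rightarrow> ('m \<Rightarrow> real ^ 'n) \<Rightarrow> 'm \<Rightarrow> real ^ 'n" where
  "lie_bracket A X Y p =
     (THE w. \<forall>f. smooth_fun A f \<longrightarrow>
        differential A f p w = along A X (along A Y f) p - along A Y (along A X f) p)"


section \<open>Riemannian metrics and the Levi-Civita connection\<close>

text \<open>
  Covariant tensor fields are treated as operators on vector fields with values in functions;
  a metric \<open>g\<close> is a family of inner products on the tangent spaces, and \<open>on_fields g\<close> is the
  corresponding operator.
\<close>

definition on_fields ::
    "('m \<Rightarrow> real ^ 'n \<Rightarrow> real ^ 'n \<Rightarrow> real) \<Rightarrow> ('m \<Rightarrow> real ^ 'n) \<Rightarrow> ('m \<Rightarrow> real ^ 'n) \<Rightarrow> 'm \<Rightarrow> real" where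
  "on_fields g X Y p = g p (X p) (Y p)"

definition riemannian_metric ::
    "('m::{t2_space, second_countable_topology}, 'n::finite) chart set \<Rightarrow>
      ('m \<Rightarrow> real ^ 'n \<Rightarrow> real ^ 'n \<Rightarrow> real) \<Rightarrow> bool" where
  "riemannian_metric A g \<longleftrightarrow>
     (\<forall>p. bilinear (g p)) \<and>
     (\<forall>p v w. g p v w = g p w v) \<and>
     (\<forall>p v. v \<noteq> 0 \<longrightarrow> g p v v > 0) \<and>
     (\<forall>X\<in>vector_fields A. \<forall>Y\<in>vector_fields A. smooth_fun A (on_fields g X Y))"

definition affine_connection ::
    "('m::{t2_space, second_countable_topology}, 'n::finite) chart set \<Rightarrow>
      (('m \<Rightarrow> real ^ 'n) \<Rightarrow> ('m \<Rightarrow> real ^ 'n) \<Rightarrow> 'm \<Rightarrow> real ^ 'n) \<Rightarrow> bool" where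
  "affine_connection A D \<longleftrightarrow>
     (\<forall>X\<in>vector_fields A. \<forall>Y\<in>vector_fields A. D X Y \<in> vector_fields A) \<and>
     (\<forall>X\<in>vector_fields A. \<forall>X'\<in>vector_fields A. \<forall>Y\<in>vector_fields A.
        D (\<lambda>p. X p + X' p) Y = (\<lambda>p. D X Y p + D X' Y p)) \<and>
     (\<forall>f. smooth_fun A f \<longrightarrow> (\<forall>X\<in>vector_fields A. \<forall>Y\<in>vector_fields A.
        D (\<lambda>p. f p *\<^sub>R X p) Y = (\<lambda>p. f p *\<^sub>R D X Y p))) \<and>
     (\<forall>X\<in>vector_fields A. \<forall>Y\<in>vector_fields A. \<forall>Y'\<in>vector_fields A.
        D X (\<lambda>p. Y p + Y' p) = (\<lambda>p. D X Y p + D X Y' p)) \<and>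
     (\<forall>f. smooth_fun A f \<longrightarrow> (\<forall>X\<in>vector_fields A. \<forall>Y\<in>vector_fields A.
        D X (\<lambda>p. f p *\<^sub>R Y p) = (\<lambda>p. along A X f p *\<^sub>R Y p + f p *\<^sub>R D X Y p)))"

text \<open>
  By the fundamental theorem of Riemannian geometry exactly one operator on the smooth vector
  fields satisfies the following; the values of \<open>D\<close> on non-smooth arguments are irrelevant.
\<close>

definition levi_civita ::
    "('m::{t2_space, second_countable_topology}, 'n::finite) chart set \<Rightarrow>
      ('m \<Rightarrow> real ^ 'n \<Rightarrow> real ^ 'n \<Rightarrow> real) \<Rightarrow>
      (('m \<Rightarrow> real ^ 'n) \<Rightarrow> ('m \<Rightarrow> real ^ 'n) \<Rightarrow> 'm \<Rightarrow> real ^ 'n) \<Rightarrow> bool" where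
  "levi_civita A g D \<longleftrightarrow>
     affine_connection A D \<and>
     (\<forall>X\<in>vector_fields A. \<forall>Y\<in>vector_fields A.
        (\<lambda>p. D X Y p - D Y X p) = lie_bracket A X Y) \<and>
     (\<forall>X\<in>vector_fields A. \<forall>Y\<in>vector_fields A. \<forall>Z\<in>vector_fields A.
        along A X (on_fields g Y Z) = (\<lambda>p. on_fields g (D X Y) Z p + on_fields g Y (D X Z) p))"

definition gradient ::
    "('m, 'n::finite) chart set \<Rightarrow> ('m \<Rightarrow> real ^ 'n \<Rightarrow> real ^ 'n \<Rightarrow> real) \<Rightarrow>
      ('m \<Rightarrow> real) \<Rightarrow> 'm \<Rightarrow> real ^ 'n" where
  "gradient A g f p = (THE w. \<forall>v. g p w v = differential A f p v)"

definition lie_derivative_metric ::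
    "('m::{t2_space, second_countable_topology}, 'n::finite) chart set \<Rightarrow>
      ('m \<Rightarrow> real ^ 'n) \<Rightarrow> ('m \<Rightarrow> real ^ 'n \<Rightarrow> real ^ 'n \<Rightarrow> real) \<Rightarrow>
      ('m \<Rightarrow> real ^ 'n) \<Rightarrow> ('m \<Rightarrow> real ^ 'n) \<Rightarrow> 'm \<Rightarrow> real" where
  "lie_derivative_metric A V g X Y p =
     along A V (on_fields g X Y) p
       - on_fields g (lie_bracket A V X) Y p - on_fields g X (lie_bracket A V Y) p"

definition covariant_derivative2 ::
    "('m, 'n::finite) chart set \<Rightarrow> (('m \<Rightarrow> real ^ 'n) \<Rightarrow> ('m \<Rightarrow> real ^ 'n) \<Rightarrow> 'm \<Rightarrow> real ^ 'n) \<Rightarrow>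
      (('m \<Rightarrow> real ^ 'n) \<Rightarrow> ('m \<Rightarrow> real ^ 'n) \<Rightarrow> 'm \<Rightarrow> real) \<Rightarrow>
      ('m \<Rightarrow> real ^ 'n) \<Rightarrow> ('m \<Rightarrow> real ^ 'n) \<Rightarrow> ('m \<Rightarrow> real ^ 'n) \<Rightarrow> 'm \<Rightarrow> real" where
  "covariant_derivative2 A D T X Y Z p =
     along A X (T Y Z) p - T (D X Y) Z p - T Y (D X Z) p"


section \<open>Curvature\<close>

definition curvature ::
    "('m::{t2_space, second_countable_topology}, 'n::finite) chart set \<Rightarrow>
      (('m \<Rightarrow> real ^ 'n) \<Rightarrow> ('m \<Rightarrow> real ^ 'n) \<Rightarrow> 'm \<Rightarrow> real ^ 'n) \<Rightarrow>
      ('m \<Rightarrow> real ^ 'n) \<Rightarrow> ('m \<Rightarrow> real ^ 'n) \<Rightarrow> ('m \<Rightarrow> real ^ 'n) \<Rightarrow> 'm \<Rightarrow> real ^ 'n" where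
  "curvature A D X Y Z p = D X (D Y Z) p - D Y (D X Z) p - D (lie_bracket A X Y) Z p"

definition curvature4 ::
    "('m::{t2_space, second_countable_topology}, 'n::finite) chart set \<Rightarrow>
      ('m \<Rightarrow> real ^ 'n \<Rightarrow> real ^ 'n \<Rightarrow> real) \<Rightarrow>
      (('m \<Rightarrow> real ^ 'n) \<Rightarrow> ('m \<Rightarrow> real ^ 'n) \<Rightarrow> 'm \<Rightarrow> real ^ 'n) \<Rightarrow>
      ('m \<Rightarrow> real ^ 'n) \<Rightarrow> ('m \<Rightarrow> real ^ 'n) \<Rightarrow> ('m \<Rightarrow> real ^ 'n) \<Rightarrow> ('m \<Rightarrow> real ^ 'n) \<Rightarrow> 'm \<Rightarrow> real" where
  "curvature4 A g D X Y Z W = on_fields g (curvature A D X Y Z) W"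

text \<open>
  The value of \<open>R(X,Y)Z\<close> at \<open>p\<close> depends on \<open>X\<close> only through \<open>X p\<close>, so that
  \<open>X \<mapsto> R(X,Y)Z\<close> induces an endomorphism of the tangent space at \<open>p\<close>, evaluated on a vector \<open>v\<close>
  by means of any smooth vector field through \<open>v\<close>.
\<close>

definition extend_vector ::
    "('m::{t2_space, second_countable_topology}, 'n::finite) chart set \<Rightarrow>
      'm \<Rightarrow> real ^ 'n \<Rightarrow> 'm \<Rightarrow> real ^ 'n" where
  "extend_vector A p v = (SOME X. X \<in> vector_fields A \<and> X p = v)"

definition ricci ::
    "('m::{t2_space, second_countable_topology}, 'n::finite) chart set \<Rightarrow>
      (('m \<Rightarrow> real ^ 'n) \<Rightarrow> ('m \<Rightarrow> real ^ 'n) \<Rightarrow> 'm \<Rightarrow> real ^ 'n) \<Rightarrow>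
      ('m \<Rightarrow> real ^ 'n) \<Rightarrow> ('m \<Rightarrow> real ^ 'n) \<Rightarrow> 'm \<Rightarrow> real" where
  "ricci A D Y Z p = trace (matrix (\<lambda>v. curvature A D (extend_vector A p v) Y Z p))"


section \<open>Almost Riemann solitons\<close>

definition kulkarni_nomizu ::
    "('v \<Rightarrow> 'v \<Rightarrow> 'm \<Rightarrow> real) \<Rightarrow> ('v \<Rightarrow> 'v \<Rightarrow> 'm \<Rightarrow> real) \<Rightarrow> 'v \<Rightarrow> 'v \<Rightarrow> 'v \<Rightarrow> 'v \<Rightarrow> 'm \<Rightarrow> real" where
  "kulkarni_nomizu T1 T2 X Y Z W p =
     T1 X W p * T2 Y Z p + T1 Y Z p * T2 X W p - T1 X Z p * T2 Y W p - T1 Y W p * T2 X Z p"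

definition G_tensor ::
    "('m \<Rightarrow> real ^ 'n \<Rightarrow> real ^ 'n \<Rightarrow> real) \<Rightarrow>
      ('m \<Rightarrow> real ^ 'n) \<Rightarrow> ('m \<Rightarrow> real ^ 'n) \<Rightarrow> ('m \<Rightarrow> real ^ 'n) \<Rightarrow> ('m \<Rightarrow> real ^ 'n) \<Rightarrow> 'm \<Rightarrow> real" where
  "G_tensor g X Y Z W p = 1/2 * kulkarni_nomizu (on_fields g) (on_fields g) X Y Z W p"

definition almost_riemann_soliton ::
    "('m::{t2_space, second_countable_topology}, 'n::finite) chart set \<Rightarrow>
      ('m \<Rightarrow> real ^ 'n \<Rightarrow> real ^ 'n \<Rightarrow> real) \<Rightarrow>
      (('m \<Rightarrow> real ^ 'n) \<Rightarrow> ('m \<Rightarrow> real ^ 'n) \<Rightarrow> 'm \<Rightarrow> real ^ 'n) \<Rightarrow>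
      ('m \<Rightarrow> real ^ 'n) \<Rightarrow> ('m \<Rightarrow> real) \<Rightarrow> bool" where
  "almost_riemann_soliton A g D V l \<longleftrightarrow>
     V \<in> vector_fields A \<and> (\<forall>p. V p \<noteq> 0) \<and> smooth_fun A l \<and>
     (\<forall>X\<in>vector_fields A. \<forall>Y\<in>vector_fields A. \<forall>Z\<in>vector_fields A. \<forall>W\<in>vector_fields A. \<forall>p.
        kulkarni_nomizu (\<lambda>X Y p. 1/2 * lie_derivative_metric A V g X Y p) (on_fields g) X Y Z W p
          + curvature4 A g D X Y Z W p = l p * G_tensor g X Y Z W p)"

end

theory Submission
  imports Defs
begin

text \<open>
  Since \<open>\<nabla>V = aI\<close> gives \<open>\<pounds>\<^sub>V g = 2ag\<close>, the soliton equation reads \<open>R = \<mu>G\<close> with \<open>\<mu> = \<lambda> - 2a\<close>.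
  Hence \<open>Ric = (n - 1)\<mu>g\<close> and \<open>\<nabla>Ric = (n - 1) d\<mu> \<otimes> g\<close>, which turns all four claims into
  linear algebra at a point. To pass from vector fields to single tangent vectors, every
  tangent vector is extended to a smooth vector field by means of a bump function.
\<close>

section \<open>Calculus of \<open>C\<^sup>k\<close> functions\<close>

lemma Ck_on_SucD:
  assumes "Ck_on (Suc k) S f"
  shows "x \<in> S \<Longrightarrow> (f has_derivative frechet_derivative f (at x)) (at x)"
    and "Ck_on k S (\<lambda>x. frechet_derivative f (at x) v)"
  using assms by (auto simp: frechet_derivative_works)

text \<open>Each derivative is taken at a point of \<open>S\<close> but depends on the function
  nearby. Since \<open>S\<close> is open, agreement on \<open>S\<close> is agreement near each of
  its points, so the Frechet derivatives agree on \<open>S\<close> as well and the induction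
  proceeds.\<close>

lemma Ck_on_cong:
  assumes "open S" "\<And>x. x \<in> S \<Longrightarrow> f x = g x" "Ck_on k S f"
  shows "Ck_on k S g"
  using assms(2,3)
proof (induction k arbitrary: f g)
  case 0
  then show ?case by (metis Ck_on.simps(1) continuous_on_cong)
next
  case (Suc k)
  have der: "(g has_derivative frechet_derivative f (at x)) (at x)" if "x \<in> S" for x
    using has_derivative_transform_within_open[OF Ck_on_SucD(1)[OF Suc.prems(2) that] assms(1) that]
      Suc.prems(1) by auto
  have "Ck_on k S (\<lambda>x. frechet_derivative g (at x) v)" for v
  proof (rule Suc.IH)
    show "Ck_on k S (\<lambda>x. frechet_derivative f (at x) v)"
      using Suc.prems(2) by simp
    show "frechet_derivative f (at x) v = frechet_derivative g (at x) v" if "x \<in> S" for x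
      using frechet_derivative_at[OF der[OF that]] by simp
  qed
  then show ?case using der by (auto simp: differentiable_def)
qed

text \<open>Replaces the choice hidden in \<open>frechet_derivative\<close> by any explicit
  derivative formula, which is how all the closure rules below are proved.\<close>

lemma Ck_on_SucI:
  assumes "open S" "\<And>x. x \<in> S \<Longrightarrow> (f has_derivative f' x) (at x)"
    and "\<And>v. Ck_on k S (\<lambda>x. f' x v)"
  shows "Ck_on (Suc k) S f"
proof -
  have "Ck_on k S (\<lambda>x. frechet_derivative f (at x) v)" for v
    by (rule Ck_on_cong[OF assms(1) _ assms(3)])
      (simp add: frechet_derivative_at[OF assms(2), symmetric])
  then show ?thesis using assms(2) by (auto simp: differentiable_def)
qed

lemma Ck_on_Suc_imp:
  "Ck_on (Suc k) S f \<Longrightarrow> Ck_on k S f"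
proof (induction k arbitrary: f)
  case 0
  then show ?case
    by (auto intro!: differentiable_imp_continuous_on simp: differentiable_on_def differentiable_at_withinI)
next
  case (Suc k)
  show ?case
    unfolding Ck_on.simps(2)[of k] using Suc.prems Suc.IH[OF Ck_on_SucD(2)[OF Suc.prems]] by simp
qed

lemma Ck_on_Un:
  assumes "open S" "open T" "Ck_on k S f" "Ck_on k T f"
  shows "Ck_on k (S \<union> T) f"
  using assms(3,4)
proof (induction k arbitrary: f)
  case 0
  then show ?case using continuous_on_open_Un[OF assms(1,2)] by simp
qed auto

lemma Ck_on_const: "Ck_on k S (\<lambda>x. c)"
  by (induction k arbitrary: c) auto

lemma Ck_on_ident: "open S \<Longrightarrow> Ck_on k S (\<lambda>x. x)"
proof (cases k)
  case (Suc m)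
  assume "open S"
  then show ?thesis unfolding Suc
    by (rule Ck_on_SucI[where f' = "\<lambda>_ v. v"]) (auto intro: Ck_on_const)
qed simp

lemma Ck_on_add:
  assumes "open S" "Ck_on k S f" "Ck_on k S g"
  shows "Ck_on k S (\<lambda>x. f x + g x)"
  using assms(2,3)
proof (induction k arbitrary: f g)
  case (Suc k)
  show ?case
    by (rule Ck_on_SucI[OF assms(1) has_derivative_add[OF Ck_on_SucD(1) Ck_on_SucD(1)]])
      (use Suc in auto)
qed (auto intro: continuous_on_add)

lemma Ck_on_sum:
  assumes "open S" "\<And>i. i \<in> I \<Longrightarrow> Ck_on k S (f i)"
  shows "Ck_on k S (\<lambda>x. \<Sum>i\<in>I. f i x)"
  using assms(2)
  by (induction I rule: infinite_finite_induct) (auto intro: Ck_on_const Ck_on_add[OF assms(1)])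

text \<open>The Leibniz rule yields two terms of the same shape \<open>h _ _\<close>, with one
  factor differentiated, so the induction closes once \<open>f\<close> and \<open>g\<close> are
  arbitrary. Products, scalings and inner products are all instances.\<close>

lemma bounded_bilinear_Ck_on:
  assumes "bounded_bilinear h" "open S" "Ck_on k S f" "Ck_on k S g"
  shows "Ck_on k S (\<lambda>x. h (f x) (g x))"
  using assms(3,4)
proof (induction k arbitrary: f g)
  case (Suc k)
  show ?case
  proof (rule Ck_on_SucI[OF assms(2)])
    show "((\<lambda>x. h (f x) (g x)) has_derivative
        (\<lambda>v. h (f x) (frechet_derivative g (at x) v) + h (frechet_derivative f (at x) v) (g x))) (at x)"
      if "x \<in> S" for x
      using Suc.prems that by (intro bounded_bilinear.FDERIV[OF assms(1)] Ck_on_SucD(1))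
    show "Ck_on k S (\<lambda>x. h (f x) (frechet_derivative g (at x) v) + h (frechet_derivative f (at x) v) (g x))" for v
      using Suc.prems by (intro Ck_on_add[OF assms(2)] Suc.IH Ck_on_SucD(2)) (blast intro: Ck_on_Suc_imp)+
  qed
qed (auto intro: bounded_bilinear.continuous_on[OF assms(1)])

text \<open>In the chain rule the direction \<open>f' x v\<close> fed to the derivative of
  \<open>g\<close> moves with \<open>x\<close>, whereas \<open>Ck_on\<close> controls fixed
  directions only. Expanding that direction in the basis of the Euclidean middle space leaves a
  finite sum of products of functions covered by the induction hypothesis.\<close>

lemma Ck_on_compose:
  fixes f :: "'a::real_normed_vector \<Rightarrow> 'b::euclidean_space"
  assumes "open S" "f ` S \<subseteq> T" "Ck_on k S f" "Ck_on k T g"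
  shows "Ck_on k S (\<lambda>x. g (f x))"
  using assms(3,4)
proof (induction k arbitrary: g)
  case 0
  then show ?case using assms(2) by (auto intro: continuous_on_compose2)
next
  case (Suc k)
  let ?f' = "\<lambda>x. frechet_derivative f (at x)" and ?g' = "\<lambda>y. frechet_derivative g (at y)"
  have der: "((\<lambda>x. g (f x)) has_derivative (\<lambda>v. \<Sum>i\<in>Basis. (?f' x v \<bullet> i) *\<^sub>R ?g' (f x) i)) (at x)"
    if "x \<in> S" for x
  proof -
    have dg: "(g has_derivative ?g' (f x)) (at (f x))"
      using Suc.prems(2) assms(2) that by (intro Ck_on_SucD(1)) auto
    have "((\<lambda>x. g (f x)) has_derivative (\<lambda>v. ?g' (f x) (?f' x v))) (at x)"
      using has_derivative_compose[OF Ck_on_SucD(1)[OF Suc.prems(1) that] dg] .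
    moreover have "?g' (f x) w = (\<Sum>i\<in>Basis. (w \<bullet> i) *\<^sub>R ?g' (f x) i)" for w
    proof -
      have lin: "linear (?g' (f x))"
        using dg by (rule has_derivative_linear)
      have "?g' (f x) w = ?g' (f x) (\<Sum>i\<in>Basis. (w \<bullet> i) *\<^sub>R i)"
        by (simp add: euclidean_representation)
      then show ?thesis
        by (simp add: linear_sum[OF lin] linear_scale[OF lin])
    qed
    ultimately show ?thesis
      by (rule has_derivative_eq_rhs[OF _ ext])
  qed
  have "Ck_on k S (\<lambda>x. (?f' x v \<bullet> i) *\<^sub>R ?g' (f x) i)" for v i
    by (rule bounded_bilinear_Ck_on[OF bounded_bilinear_scaleR assms(1)
          bounded_bilinear_Ck_on[OF bounded_bilinear_inner assms(1)
            Ck_on_SucD(2)[OF Suc.prems(1)] Ck_on_const]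
          Suc.IH[OF Ck_on_Suc_imp[OF Suc.prems(1)] Ck_on_SucD(2)[OF Suc.prems(2)]]])
  then show ?case
    by (intro Ck_on_SucI[OF assms(1) der] Ck_on_sum[OF assms(1)])
qed

section \<open>Smooth bump functions from exp(-1/t)\<close>

definition flat_exp :: "nat \<Rightarrow> real \<Rightarrow> real" where
  "flat_exp m t = (if t > 0 then exp (- inverse t) * inverse t ^ m else 0)"

text \<open>On the right, the substitution x = 1/t turns the claim into the decay of x^m / exp x at
  infinity; on the left the function is 0.\<close>

lemma flat_exp_tendsto_0: "(flat_exp m \<longlongrightarrow> 0) (at 0)"
proof -
  have "((\<lambda>x::real. x ^ m / exp x) \<longlongrightarrow> 0) at_top"
    by (rule tendsto_power_div_exp_0)
  then have "((\<lambda>t::real. inverse t ^ m / exp (inverse t)) \<longlongrightarrow> 0) (at_right 0)"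
    by (rule filterlim_compose[OF _ filterlim_inverse_at_top_right])
  then have "(flat_exp m \<longlongrightarrow> 0) (at_right 0)"
    by (rule Lim_transform_eventually)
      (auto simp: flat_exp_def exp_minus divide_inverse mult.commute
        intro!: eventually_at_rightI[of 0 1])
  moreover have "(flat_exp m \<longlongrightarrow> 0) (at_left 0)"
    by (rule Lim_transform_eventually[OF tendsto_const])
      (auto simp: flat_exp_def intro!: eventually_at_leftI[of "-1"])
  ultimately show ?thesis by (simp add: filterlim_split_at)
qed

text \<open>The parameter \<open>m\<close> exists for this formula: the family exp(-1/t) / t^m,
  extended by 0, has derivatives that are linear combinations of its own members, so smoothness
  follows by induction for all \<open>m\<close> at once.\<close>

lemma flat_exp_deriv:
  "(flat_exp m has_field_derivative flat_exp (m + 2) t + (- real m) * flat_exp (m + 1) t) (at t)"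
proof -
  consider "t > 0" | "t < 0" | "t = 0" by linarith
  then show ?thesis
  proof cases
    case 1
    have "((\<lambda>t. exp (- inverse t) * inverse t ^ m) has_field_derivative
        flat_exp (m + 2) t + (- real m) * flat_exp (m + 1) t) (at t)"
      \<comment> \<open>The power rule produces the exponent \<open>m - 1\<close>, which truncates
        at \<open>m = 0\<close>; hence the case split.\<close>
      using 1 by (cases m) (auto intro!: derivative_eq_intros
          simp: flat_exp_def field_simps power2_eq_square, metis One_nat_def power_eq_if)
    then show ?thesis
      by (rule has_field_derivative_transform_within_open[of _ _ _ "{0<..}"])
        (use 1 in \<open>auto simp: flat_exp_def\<close>)
  next
    case 2
    have "((\<lambda>t. 0) has_field_derivative 0) (at t)" by simp
    then have "(flat_exp m has_field_derivative 0) (at t)"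
      by (rule has_field_derivative_transform_within_open[of _ _ _ "{..<0}"])
        (use 2 in \<open>auto simp: flat_exp_def\<close>)
    then show ?thesis using 2 by (simp add: flat_exp_def)
  next
    case 3
    \<comment> \<open>At 0 the difference quotient of \<open>flat_exp m\<close> is
      \<open>flat_exp (Suc m)\<close> itself, which tends to 0.\<close>
    have "((\<lambda>h. (flat_exp m (0 + h) - flat_exp m 0) / h) \<longlongrightarrow> 0) (at 0)"
      by (rule Lim_transform_eventually[OF flat_exp_tendsto_0[of "Suc m"]])
        (auto simp: flat_exp_def divide_inverse)
    then show ?thesis using 3 by (simp add: DERIV_def flat_exp_def)
  qed
qed

lemma Ck_on_flat_exp: "Ck_on k UNIV (flat_exp m)"
proof (induction k arbitrary: m)
  case 0
  show ?case
    using flat_exp_deriv by (auto intro!: DERIV_isCont continuous_at_imp_continuous_on)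
next
  case (Suc k)
  show ?case
    by (rule Ck_on_SucI[OF open_UNIV flat_exp_deriv[THEN has_field_derivative_imp_has_derivative]])
      (intro bounded_bilinear_Ck_on[OF bounded_bilinear_mult] Ck_on_add Ck_on_const open_UNIV Suc)
qed

text \<open>\<open>flat_exp 0\<close> applied to r^2 - |y - c|^2 vanishes outside the ball; dividing
  by its value at the centre normalises it.\<close>

lemma bump_exists:
  fixes c :: "'a::euclidean_space"
  assumes "r > 0"
  obtains b :: "'a \<Rightarrow> real"
  where "\<And>k. Ck_on k UNIV b" "b c = 1" "\<And>y. y \<notin> cball c r \<Longrightarrow> b y = 0"
proof
  \<comment> \<open>Only sums, products and inner products occur, so that the closure rules for
    \<open>Ck_on\<close> match the term literally.\<close>
  let ?q = "\<lambda>y. r\<^sup>2 + (- 1) * ((y + - c) \<bullet> (y + - c))"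
  let ?b = "\<lambda>y. inverse (flat_exp 0 (r\<^sup>2)) * flat_exp 0 (?q y)"
  show "Ck_on k UNIV ?b" for k
    by (intro bounded_bilinear_Ck_on[OF bounded_bilinear_mult] Ck_on_const open_UNIV
        Ck_on_compose[OF open_UNIV subset_UNIV _ Ck_on_flat_exp] Ck_on_add
        bounded_bilinear_Ck_on[OF bounded_bilinear_inner] Ck_on_ident)
  show "?b c = 1" using assms by (simp add: flat_exp_def)
  show "?b y = 0" if "y \<notin> cball c r" for y
  proof -
    have "r\<^sup>2 \<le> (norm (y - c))\<^sup>2"
      using that assms by (intro power_mono) (auto simp: dist_norm norm_minus_commute)
    then show ?thesis
      by (simp add: flat_exp_def power2_norm_eq_inner)
  qed
qed

section \<open>Extension of tangent vectors\<close>

lemma smooth_atlasD: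
  assumes "smooth_atlas A"
  shows "c \<in> A \<Longrightarrow> is_chart c"
    and "(\<Union>c\<in>A. fst c) = UNIV"
    and "c \<in> A \<Longrightarrow> d \<in> A \<Longrightarrow> Ck_on k (snd c ` (fst c \<inter> fst d)) (snd d \<circ> chart_inv c)"
  using assms by (simp_all only: smooth_atlas_def smooth_on_def)

lemma is_chartD:
  assumes "is_chart c"
  shows "open (fst c)" "open (snd c ` fst c)"
    "homeomorphism (fst c) (snd c ` fst c) (snd c) (chart_inv c)"
  using assms by (simp_all only: is_chart_def)

lemma chart_at_props:
  assumes "smooth_atlas A"
  shows "chart_at A p \<in> A" "p \<in> fst (chart_at A p)"
proof -
  have "p \<in> (\<Union>c\<in>A. fst c)"
    by (simp only: smooth_atlasD(2)[OF assms] UNIV_I)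
  then have "\<exists>c. c \<in> A \<and> p \<in> fst c"
    by blast
  from someI_ex[OF this] show "chart_at A p \<in> A" "p \<in> fst (chart_at A p)"
    by (auto simp: chart_at_def)
qed

lemma chart_inv_coord:
  "is_chart c \<Longrightarrow> p \<in> fst c \<Longrightarrow> chart_inv c (snd c p) = p"
  by (rule homeomorphism_apply1[OF is_chartD(3)])

lemma open_coord_image:
  assumes "is_chart c" "open W"
  shows "open (snd c ` (fst c \<inter> W))"
  by (rule openin_open_trans[OF homeomorphism_imp_open_map[OF is_chartD(3)[OF assms(1)]
          openin_open_Int[OF assms(2)]] is_chartD(2)[OF assms(1)]])

lemma transition_has_derivative:
  assumes "smooth_atlas A" "c \<in> A" "d \<in> A" "q \<in> fst c" "q \<in> fst d"
  shows "(snd d \<circ> chart_inv c has_derivative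
      frechet_derivative (snd d \<circ> chart_inv c) (at (snd c q))) (at (snd c q))"
  by (rule Ck_on_SucD(1)[OF smooth_atlasD(3)[OF assms(1-3)]]) (use assms in auto)

text \<open>This is the chain rule for the change of charts from \<open>c\<close> through
  \<open>d\<close> to \<open>e\<close>. The composite equals the direct transition only on the
  coordinate image of the overlap of \<open>c\<close> and \<open>d\<close>, which is an open
  neighbourhood of the point and therefore suffices.\<close>

lemma transition_cocycle:
  assumes "smooth_atlas A" "c \<in> A" "d \<in> A" "e \<in> A" "q \<in> fst c" "q \<in> fst d" "q \<in> fst e"
  shows "frechet_derivative (snd e \<circ> chart_inv d) (at (snd d q))
      (frechet_derivative (snd d \<circ> chart_inv c) (at (snd c q)) v)
    = frechet_derivative (snd e \<circ> chart_inv c) (at (snd c q)) v"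
proof -
  note chart = smooth_atlasD(1)[OF assms(1,2)] smooth_atlasD(1)[OF assms(1,3)]
  note op = is_chartD(1)[OF chart(2)]
  let ?F = "\<lambda>c d q. frechet_derivative (snd d \<circ> chart_inv c) (at (snd c q))"
  have "((snd e \<circ> chart_inv d) \<circ> (snd d \<circ> chart_inv c) has_derivative ?F d e q \<circ> ?F c d q) (at (snd c q))"
  proof (rule diff_chain_at)
    show "(snd d \<circ> chart_inv c has_derivative ?F c d q) (at (snd c q))"
      using assms by (intro transition_has_derivative)
    show "(snd e \<circ> chart_inv d has_derivative ?F d e q) (at ((snd d \<circ> chart_inv c) (snd c q)))"
      using transition_has_derivative[OF assms(1,3,4)] assms by (simp add: chart_inv_coord[OF chart(1)])
  qed
  then have "(snd e \<circ> chart_inv c has_derivative ?F d e q \<circ> ?F c d q) (at (snd c q))"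
    by (rule has_derivative_transform_within_open[OF _ open_coord_image[OF chart(1) op]])
      (use assms in \<open>auto simp: chart_inv_coord chart\<close>)
  from frechet_derivative_at[OF this] show ?thesis by (metis comp_apply)
qed

text \<open>The constant field \<open>v\<close> in the chart chosen at \<open>p\<close> is cut off
  by a bump function and extended by 0.\<close>

lemma vector_field_extension:
  fixes A :: "('m::{t2_space, second_countable_topology}, 'n::finite) chart set"
  assumes A: "smooth_atlas A"
  shows "\<exists>X. X \<in> vector_fields A \<and> X p = v"
proof -
  define c0 where "c0 = chart_at A p"
  note c0 = chart_at_props[OF A, of p, folded c0_def]
  note chart = smooth_atlasD(1)[OF A]
  note op = is_chartD(1,2)[OF chart[OF c0(1)]]
  obtain r where r: "r > 0" "cball (snd c0 p) r \<subseteq> snd c0 ` fst c0"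
    using op(2) c0(2) by (metis open_contains_cball imageI)
  obtain b :: "real ^ 'n \<Rightarrow> real" where b: "\<And>k. Ck_on k UNIV b" "b (snd c0 p) = 1"
    "\<And>y. y \<notin> cball (snd c0 p) r \<Longrightarrow> b y = 0"
    using bump_exists[OF r(1)] by metis
  \<comment> \<open>\<open>K\<close> contains the support of the field. It is compact, hence closed
    in the Hausdorff space, so its complement is open.\<close>
  define K where "K = chart_inv c0 ` cball (snd c0 p) r"
  have "continuous_on (cball (snd c0 p) r) (chart_inv c0)"
    by (rule continuous_on_subset[OF homeomorphism_cont2[OF is_chartD(3)[OF chart[OF c0(1)]]] r(2)])
  then have "closed K"
    unfolding K_def by (intro compact_imp_closed compact_continuous_image compact_cball)
  have "K \<subseteq> fst c0"
    unfolding K_def using r(2) by (auto simp: chart_inv_coord[OF chart[OF c0(1)]] dest!: subsetD)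
  have b_K: "b (snd c0 q) = 0" if "q \<in> fst c0" "q \<notin> K" for q
    using b(3)[of "snd c0 q"] that chart_inv_coord[OF chart[OF c0(1)] that(1)]
    unfolding K_def by (metis imageI)
  let ?F = "\<lambda>c d x. frechet_derivative (snd d \<circ> chart_inv c) (at x)"
  \<comment> \<open>A tangent vector at \<open>q\<close> is stored by its components in
    \<open>chart_at A q\<close>, so the constant vector \<open>v\<close> must be carried from
    \<open>c0\<close> to that chart.\<close>
  define X where "X q = (if q \<in> fst c0 then b (snd c0 q) *\<^sub>R ?F c0 (chart_at A q) (snd c0 q) v else 0)" for q
  \<comment> \<open>\<open>chart_at A q\<close> may jump with \<open>q\<close>; the cocycle rule
    removes it, leaving an expression that is smooth in the coordinates.\<close>
  have comp_X: "components A c q (X q) =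
      (if q \<in> fst c0 then b (snd c0 q) *\<^sub>R ?F c0 c (snd c0 q) v else 0)"
    if c: "c \<in> A" "q \<in> fst c" for c q
  proof -
    note d = chart_at_props[OF A, of q]
    have lin: "linear (?F (chart_at A q) c (snd (chart_at A q) q))"
      using transition_has_derivative[OF A d(1) c(1) d(2) c(2)] by (rule has_derivative_linear)
    show ?thesis
      using transition_cocycle[OF A c0(1) d(1) c(1) _ d(2) c(2)]
      by (simp add: components_def X_def linear_scale[OF lin] linear_0[OF lin])
  qed
  have "Ck_on k (snd c ` fst c) (\<lambda>x. components A c (chart_inv c x) (X (chart_inv c x)))"
    if c: "c \<in> A" for c k
  proof -
    note inv = chart_inv_coord[OF chart[OF c]]
    \<comment> \<open>Two open sets cover the chart: on \<open>?S\<close> the explicit formula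
      applies, on \<open>?T\<close> the components vanish.\<close>
    let ?S = "snd c ` (fst c \<inter> fst c0)" and ?T = "snd c ` (fst c \<inter> - K)"
    let ?t = "snd c0 \<circ> chart_inv c"
    have S: "open ?S" and T: "open ?T"
      using open_coord_image[OF chart[OF c]] op(1) \<open>closed K\<close> by (simp_all add: open_Compl)
    have t: "Ck_on k ?S ?t"
      by (rule smooth_atlasD(3)[OF A c c0(1)])
    have F: "Ck_on k (snd c0 ` (fst c0 \<inter> fst c)) (\<lambda>x. ?F c0 c x v)"
      by (rule Ck_on_SucD(2)[OF smooth_atlasD(3)[OF A c0(1) c]])
    have "Ck_on k ?S (\<lambda>x. b (?t x) *\<^sub>R ?F c0 c (?t x) v)"
      by (intro bounded_bilinear_Ck_on[OF bounded_bilinear_scaleR S]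
          Ck_on_compose[OF S subset_UNIV t b(1)] Ck_on_compose[OF S _ t F]) (auto simp: inv)
    then have "Ck_on k ?S (\<lambda>x. components A c (chart_inv c x) (X (chart_inv c x)))"
      by (rule Ck_on_cong[OF S, rotated]) (auto simp: inv comp_X c)
    moreover have "Ck_on k ?T (\<lambda>x. components A c (chart_inv c x) (X (chart_inv c x)))"
      by (rule Ck_on_cong[OF T _ Ck_on_const[where c = 0]]) (auto simp: inv comp_X c b_K)
    ultimately have "Ck_on k (?S \<union> ?T) (\<lambda>x. components A c (chart_inv c x) (X (chart_inv c x)))"
      by (rule Ck_on_Un[OF S T])
    moreover have "?S \<union> ?T = snd c ` fst c"
      using \<open>K \<subseteq> fst c0\<close> by auto
    ultimately show ?thesis by (simp only:)
  qed
  then have "X \<in> vector_fields A"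
    unfolding vector_fields_def smooth_on_def by blast
  moreover have "X p = v"
  proof -
    \<comment> \<open>The transition from \<open>c0\<close> to itself is locally the identity and
      the bump is 1 at the centre, so the value at \<open>p\<close> is exactly
      \<open>v\<close>.\<close>
    have "((\<lambda>x. x) has_derivative (\<lambda>h. h)) (at (snd c0 p))" by simp
    then have "(snd c0 \<circ> chart_inv c0 has_derivative (\<lambda>h. h)) (at (snd c0 p))"
      by (rule has_derivative_transform_within_open[OF _ op(2)])
        (use c0 in \<open>auto simp: chart_inv_coord chart\<close>)
    from frechet_derivative_at[OF this] show ?thesis
      using c0 by (simp add: X_def b(2) flip: c0_def) metis
  qed
  ultimately show ?thesis by blast
qed

section \<open>Differentials\<close>

lemma smooth_fun_has_derivative:
  assumes "smooth_atlas A" "smooth_fun A f"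
  shows "(f \<circ> chart_inv (chart_at A p) has_derivative differential A f p) (at (snd (chart_at A p) p))"
proof -
  have "(f \<circ> chart_inv (chart_at A p) has_derivative
      frechet_derivative (f \<circ> chart_inv (chart_at A p)) (at (snd (chart_at A p) p)))
      (at (snd (chart_at A p) p))"
  proof (rule Ck_on_SucD(1))
    show "Ck_on (Suc 0) (snd (chart_at A p) ` fst (chart_at A p)) (f \<circ> chart_inv (chart_at A p))"
      using assms chart_at_props(1) unfolding smooth_fun_def smooth_on_def by blast
  qed (use chart_at_props[OF assms(1)] in auto)
  then show ?thesis by (simp add: differential_def[abs_def])
qed

lemma differential_eqI:
  assumes "(f \<circ> chart_inv (chart_at A p) has_derivative f') (at (snd (chart_at A p) p))"
  shows "differential A f p = f'"
  using frechet_derivative_at[OF assms] by (simp add: differential_def[abs_def])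

lemma linear_differential:
  "smooth_atlas A \<Longrightarrow> smooth_fun A f \<Longrightarrow> linear (differential A f p)"
  using smooth_fun_has_derivative has_derivative_linear by blast

lemma chart_inv_chart_at:
  "smooth_atlas A \<Longrightarrow> chart_inv (chart_at A p) (snd (chart_at A p) p) = p"
  by (intro chart_inv_coord smooth_atlasD(1)[of A] chart_at_props)

lemma differential_linear_combination:
  assumes "smooth_atlas A" "smooth_fun A f" "smooth_fun A h"
  shows "differential A (\<lambda>q. f q - c * h q) p v = differential A f p v - c * differential A h p v"
proof -
  have "differential A (\<lambda>q. f q - c * h q) p = (\<lambda>v. differential A f p v - c * differential A h p v)"
    using smooth_fun_has_derivative[OF assms(1,2), of p] smooth_fun_has_derivative[OF assms(1,3), of p]
    by (intro differential_eqI) (auto simp: o_def intro!: derivative_eq_intros)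
  then show ?thesis by simp
qed

lemma smooth_fun_linear_combination:
  assumes A: "smooth_atlas A" and f: "smooth_fun A f" and h: "smooth_fun A h"
  shows "smooth_fun A (\<lambda>q. f q - c * h q)"
  unfolding smooth_fun_def smooth_on_def
proof (intro ballI allI)
  fix d k assume d: "d \<in> A"
  let ?S = "snd d ` fst d"
  have S: "open ?S"
    by (rule is_chartD(2)[OF smooth_atlasD(1)[OF A d]])
  have "Ck_on k ?S (f \<circ> chart_inv d)" "Ck_on k ?S (h \<circ> chart_inv d)"
    using f h d unfolding smooth_fun_def smooth_on_def by blast+
  then have "Ck_on k ?S (\<lambda>x. (f \<circ> chart_inv d) x + (- c) * (h \<circ> chart_inv d) x)"
    by (intro Ck_on_add[OF S] bounded_bilinear_Ck_on[OF bounded_bilinear_mult S] Ck_on_const)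
  then show "Ck_on k ?S ((\<lambda>q. f q - c * h q) \<circ> chart_inv d)"
    by (simp add: o_def)
qed

text \<open>Shaped for the Ricci tensor, a constant times the product of \<mu> and g(Y,Z).\<close>

lemma differential_cmult_mult:
  assumes "smooth_atlas A" "smooth_fun A f" "smooth_fun A h"
  shows "differential A (\<lambda>q. c * (f q * h q)) p v
    = c * (differential A f p v * h p + f p * differential A h p v)"
proof -
  have "differential A (\<lambda>q. c * (f q * h q)) p
      = (\<lambda>v. c * (differential A f p v * h p + f p * differential A h p v))"
    using smooth_fun_has_derivative[OF assms(1,2), of p] smooth_fun_has_derivative[OF assms(1,3), of p]
    by (intro differential_eqI)
      (auto simp: o_def chart_inv_chart_at[OF assms(1)] algebra_simps intro!: derivative_eq_intros)
  then show ?thesis by simp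
qed

section \<open>Concircular solitons\<close>

lemma riesz_pos_def_bilinear:
  fixes B :: "'a::euclidean_space \<Rightarrow> 'a \<Rightarrow> real"
  assumes B: "bilinear B" and pos: "\<And>v. v \<noteq> 0 \<Longrightarrow> B v v > 0" and f: "linear f"
  shows "\<exists>!w. \<forall>v. B w v = f v"
proof -
  have linl: "linear (\<lambda>w. B w v)" and linr: "linear (B w)" for v w
    using B by (auto simp: bilinear_def)
  have zero: "w = 0" if "B w = (\<lambda>v. 0)" for w
    using pos[of w] fun_cong[OF that, of w] by force
  \<comment> \<open>The functional \<open>B w\<close> is encoded by its values on the basis as a
    vector of the same space. Positivity makes this endomorphism injective, and finite dimension
    then makes it surjective.\<close>
  let ?F = "\<lambda>w. \<Sum>b\<in>Basis. B w b *\<^sub>R b"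
  have "linear ?F"
    by (rule linearI)
      (simp_all add: linear_add[OF linl] linear_scale[OF linl] scaleR_add_left sum.distrib
        scaleR_sum_right)
  moreover have "inj ?F"
    unfolding linear_injective_0[OF \<open>linear ?F\<close>]
  proof (intro allI impI)
    fix w assume w: "?F w = 0"
    have "B w b = 0" if "b \<in> Basis" for b
      using inner_sum_left_Basis[OF that, of "B w"] w by simp
    then show "w = 0"
      by (intro zero linear_eq_stdbasis[OF linr linear_zero])
  qed
  ultimately have "surj ?F"
    by (rule linear_inj_imp_surj)
  from surjD[OF this, of "\<Sum>b\<in>Basis. f b *\<^sub>R b"]
  obtain w where w: "(\<Sum>b\<in>Basis. f b *\<^sub>R b) = ?F w"
    by blast
  have "B w b = f b" if "b \<in> Basis" for b
    using inner_sum_left_Basis[OF that, of "B w"] inner_sum_left_Basis[OF that, of f]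
    unfolding w by (rule trans[OF sym])
  then have Bw: "B w = f"
    by (intro linear_eq_stdbasis[OF linr f])
  have "w' = w" if "\<forall>v. B w' v = f v" for w'
  proof -
    have "B (w' - w) = (\<lambda>v. 0)"
      using that Bw by (simp add: fun_eq_iff linear_diff[OF linl])
    then show ?thesis using zero by force
  qed
  then show ?thesis using Bw by blast
qed

text \<open>The identity has trace n and the rank-one map v |-> f(v) y has trace f(y). With f =
  g(-,Z) and y = Y this is the contraction that gives the Ricci tensor.\<close>

lemma trace_scaleR_diff_rank_one:
  fixes y :: "real ^ 'n" and f :: "real ^ 'n \<Rightarrow> real"
  assumes "linear f"
  shows "trace (matrix (\<lambda>v. c *\<^sub>R (b *\<^sub>R v - f v *\<^sub>R y))) = c * (real CARD('n) * b - f y)"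
proof -
  have "f y = f (\<Sum>i\<in>UNIV. y $ i *\<^sub>R axis i 1)"
    by (subst basis_expansion[of y, symmetric]) (simp add: scalar_mult_eq_scaleR)
  also have "\<dots> = (\<Sum>i\<in>UNIV. f (axis i 1) * y $ i)"
    by (simp add: linear_sum[OF assms] linear_scale[OF assms] mult.commute)
  finally show ?thesis
    by (simp add: trace_def matrix_def sum_subtractf flip: sum_distrib_left)
qed

section \<open>Curvature and Ricci tensor of a concircular soliton\<close>

locale concircular_soliton =
  fixes A :: "('m::{t2_space, second_countable_topology}, 'n::finite) chart set"
    and g :: "'m \<Rightarrow> real ^ 'n \<Rightarrow> real ^ 'n \<Rightarrow> real"
    and D :: "('m \<Rightarrow> real ^ 'n) \<Rightarrow> ('m \<Rightarrow> real ^ 'n) \<Rightarrow> 'm \<Rightarrow> real ^ 'n"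
    and V :: "'m \<Rightarrow> real ^ 'n"
    and l a :: "'m \<Rightarrow> real"
  assumes atlas: "smooth_atlas A"
    and metric: "riemannian_metric A g"
    and LC: "levi_civita A g D"
    and soliton: "almost_riemann_soliton A g D V l"
    and a_smooth: "smooth_fun A a"
    and concircular: "\<And>X. X \<in> vector_fields A \<Longrightarrow> D X V = (\<lambda>p. a p *\<^sub>R X p)"
begin

text \<open>An equation between functions, so that unfolding also rewrites unapplied occurrences, as
  inside \<open>gradient\<close> and \<open>along\<close>.\<close>

definition \<mu> :: "'m \<Rightarrow> real" where
  "\<mu> = (\<lambda>q. l q - 2 * a q)"

lemma V_field: "V \<in> vector_fields A" and V_nonzero: "V p \<noteq> 0" and l_smooth: "smooth_fun A l"
  using soliton unfolding almost_riemann_soliton_def by auto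

lemma \<mu>_smooth: "smooth_fun A \<mu>"
  unfolding \<mu>_def by (rule smooth_fun_linear_combination[OF atlas l_smooth a_smooth])

lemma field_through: obtains X where "X \<in> vector_fields A" "X p = v"
  using vector_field_extension[OF atlas] by metis

lemma g_bilinear: "bilinear (g p)" and g_sym: "g p v w = g p w v"
  and g_pos: "v \<noteq> 0 \<Longrightarrow> g p v v > 0"
  and g_smooth: "\<lbrakk>X \<in> vector_fields A; Y \<in> vector_fields A\<rbrakk> \<Longrightarrow> smooth_fun A (on_fields g X Y)"
  using metric unfolding riemannian_metric_def by blast+

lemmas g_simps =
  bilinear_ladd[OF g_bilinear] bilinear_lsub[OF g_bilinear] bilinear_rsub[OF g_bilinear]
  bilinear_lneg[OF g_bilinear] bilinear_lmul[OF g_bilinear] bilinear_rmul[OF g_bilinear]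

text \<open>Nondegeneracy: testing with u = v - w would contradict positivity if v and w
  differed.\<close>

lemma g_eqI: "(\<And>u. g p v u = g p w u) \<Longrightarrow> v = w"
  using g_pos[of "v - w" p] by (force simp: g_simps)

lemma D_field: "\<lbrakk>X \<in> vector_fields A; Y \<in> vector_fields A\<rbrakk> \<Longrightarrow> D X Y \<in> vector_fields A"
  using LC unfolding levi_civita_def affine_connection_def by blast

lemma along_metric:
  assumes "X \<in> vector_fields A" "Y \<in> vector_fields A" "Z \<in> vector_fields A"
  shows "along A X (on_fields g Y Z) p = g p (D X Y p) (Z p) + g p (Y p) (D X Z p)"
proof -
  have "along A X (on_fields g Y Z) = (\<lambda>p. on_fields g (D X Y) Z p + on_fields g Y (D X Z) p)"
    using LC assms unfolding levi_civita_def by blast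
  then show ?thesis by (simp add: on_fields_def)
qed

text \<open>Vanishing torsion gives [V,Z] = D_V Z - aZ. By metric compatibility the terms with D_V
  cancel, and each of the two slots contributes one a g.\<close>

lemma lie_derivative_metric_eq:
  assumes "X \<in> vector_fields A" "Y \<in> vector_fields A"
  shows "lie_derivative_metric A V g X Y p = 2 * a p * g p (X p) (Y p)"
proof -
  have "lie_bracket A V Z p = D V Z p - a p *\<^sub>R Z p" if "Z \<in> vector_fields A" for Z
  proof -
    have "(\<lambda>p. D V Z p - D Z V p) = lie_bracket A V Z"
      using LC V_field that unfolding levi_civita_def by blast
    then show ?thesis
      by (simp add: concircular[OF that] fun_eq_iff)
  qed
  then show ?thesis
    unfolding lie_derivative_metric_def along_metric[OF V_field assms]
    using assms by (simp add: on_fields_def g_simps)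
qed

text \<open>The Lie derivative term of the soliton equation is a g \<odot> g = 2aG, so R =
  (\<lambda> - 2a)G. Pairing with an arbitrary fourth vector and using nondegeneracy recovers the
  vector R(X,Y)Z.\<close>

lemma curvature_eq:
  assumes "X \<in> vector_fields A" "Y \<in> vector_fields A" "Z \<in> vector_fields A"
  shows "curvature A D X Y Z p = \<mu> p *\<^sub>R (g p (Y p) (Z p) *\<^sub>R X p - g p (X p) (Z p) *\<^sub>R Y p)"
proof (rule g_eqI)
  fix u
  obtain W where W: "W \<in> vector_fields A" "W p = u" using field_through .
  have "kulkarni_nomizu (\<lambda>X Y p. 1/2 * lie_derivative_metric A V g X Y p) (on_fields g) X Y Z W p
          + curvature4 A g D X Y Z W p = l p * G_tensor g X Y Z W p"
    using soliton assms W unfolding almost_riemann_soliton_def by blast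
  then show "g p (curvature A D X Y Z p) u
    = g p (\<mu> p *\<^sub>R (g p (Y p) (Z p) *\<^sub>R X p - g p (X p) (Z p) *\<^sub>R Y p)) u"
    by (simp add: kulkarni_nomizu_def curvature4_def G_tensor_def on_fields_def
        lie_derivative_metric_eq assms W g_simps \<mu>_def algebra_simps)
qed

text \<open>By \<open>curvature_eq\<close> the integrand of the trace depends on the chosen
  extension only through its value \<open>v\<close> at \<open>p\<close>, so the choice in
  \<open>extend_vector\<close> is harmless. The trace is then \<mu>(n g(Y,Z) - g(Y,Z)).\<close>

lemma ricci_eq:
  assumes "Y \<in> vector_fields A" "Z \<in> vector_fields A"
  shows "ricci A D Y Z p = (real CARD('n) - 1) * (\<mu> p * g p (Y p) (Z p))"
proof -
  have ext: "extend_vector A p v \<in> vector_fields A" "extend_vector A p v p = v" for v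
    using someI_ex[OF vector_field_extension[OF atlas, of p v]] by (auto simp: extend_vector_def)
  have "linear (\<lambda>v. g p v (Z p))"
    using g_bilinear by (auto simp: bilinear_def)
  from trace_scaleR_diff_rank_one[OF this, of "\<mu> p" "g p (Y p) (Z p)" "Y p"] show ?thesis
    by (simp only: ricci_def curvature_eq[OF ext(1) assms] ext(2))
      (simp add: left_diff_distrib right_diff_distrib)
qed

text \<open>In the product rule for \<mu> g(Y,Z) the derivative of g(Y,Z) is cancelled by the two
  correction terms, since the connection is metric; only the derivative of \<mu> survives.\<close>

lemma covariant_derivative_ricci:
  assumes "X \<in> vector_fields A" "Y \<in> vector_fields A" "Z \<in> vector_fields A"
  shows "covariant_derivative2 A D (ricci A D) X Y Z p
    = (real CARD('n) - 1) * (differential A \<mu> p (X p) * g p (Y p) (Z p))"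
proof -
  have ric: "ricci A D Y Z = (\<lambda>p. (real CARD('n) - 1) * (\<mu> p * on_fields g Y Z p))"
    using ricci_eq assms by (simp add: fun_eq_iff on_fields_def)
  show ?thesis
    unfolding covariant_derivative2_def along_def ric
      differential_cmult_mult[OF atlas \<mu>_smooth g_smooth[OF assms(2,3)]]
    using along_metric[OF assms] assms
    by (simp add: ricci_eq D_field along_def on_fields_def algebra_simps)
qed

text \<open>Riesz representation turns the definite description of the gradient into a condition
  that can be tested vector by vector.\<close>

lemma gradient_eq_iff: "gradient A g \<mu> p = w \<longleftrightarrow> (\<forall>v. g p w v = differential A \<mu> p v)"
proof -
  have riesz: "\<exists>!w. \<forall>v. g p w v = differential A \<mu> p v"
    using riesz_pos_def_bilinear[OF g_bilinear g_pos linear_differential[OF atlas \<mu>_smooth]] .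
  show ?thesis
    unfolding gradient_def using the1_equality[OF riesz] theI'[OF riesz] by blast
qed

section \<open>The four claims on the Ricci tensor\<close>

context
  assumes dim: "CARD('n) \<ge> 3"
begin

lemma codim_nonzero: "real CARD('n) - 1 \<noteq> 0"
  using dim by simp

lemma ricci_symmetric_iff:
  "(\<forall>X\<in>vector_fields A. \<forall>Y\<in>vector_fields A. \<forall>Z\<in>vector_fields A. \<forall>p.
      covariant_derivative2 A D (ricci A D) X Y Z p = 0)
    \<longleftrightarrow> (\<forall>p v. differential A \<mu> p v = 0)" (is "?L \<longleftrightarrow> ?R")
proof
  assume L: ?L
  show ?R
  proof (intro allI)
    fix p v
    obtain X where X: "X \<in> vector_fields A" "X p = v" using field_through .
    show "differential A \<mu> p v = 0"
      \<comment> \<open>With Y = Z = V the remaining factor g(V,V) is positive because V vanishes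
        nowhere, so it cancels together with n - 1.\<close>
      using L[rule_format, OF X(1) V_field V_field, of p] covariant_derivative_ricci[OF X(1) V_field V_field, of p]
        g_pos[OF V_nonzero, of p p] codim_nonzero X by auto
  qed
qed (simp add: covariant_derivative_ricci)

lemma ricci_recurrent_iff:
  "(\<forall>X\<in>vector_fields A. \<forall>Y\<in>vector_fields A. \<forall>Z\<in>vector_fields A. \<forall>p.
      covariant_derivative2 A D (ricci A D) X Y Z p = g p (X p) (V p) * ricci A D Y Z p)
    \<longleftrightarrow> (\<forall>p. gradient A g \<mu> p = \<mu> p *\<^sub>R V p)" (is "?L \<longleftrightarrow> ?R")
proof
  assume L: ?L
  show ?R
    unfolding gradient_eq_iff
  proof (intro allI)
    fix p v
    obtain X where X: "X \<in> vector_fields A" "X p = v" using field_through .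
    \<comment> \<open>Again Y = Z = V, to divide by g(V,V) afterwards.\<close>
    have "differential A \<mu> p v * g p (V p) (V p) = g p v (V p) * \<mu> p * g p (V p) (V p)"
      using L[rule_format, OF X(1) V_field V_field, of p] codim_nonzero X V_field
      by (simp add: covariant_derivative_ricci ricci_eq)
    then show "g p (\<mu> p *\<^sub>R V p) v = differential A \<mu> p v"
      using g_pos[OF V_nonzero, of p p] by (simp add: g_simps g_sym)
  qed
next
  assume R: ?R
  have "differential A \<mu> p v = \<mu> p * g p v (V p)" for p v
    using R[unfolded gradient_eq_iff, rule_format, of p v] by (simp add: g_simps g_sym)
  then show ?L by (simp add: covariant_derivative_ricci ricci_eq)
qed

lemma ricci_codazzi_iff:
  "(\<forall>X\<in>vector_fields A. \<forall>Y\<in>vector_fields A. \<forall>Z\<in>vector_fields A. \<forall>p.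
      covariant_derivative2 A D (ricci A D) X Y Z p = covariant_derivative2 A D (ricci A D) Y X Z p)
    \<longleftrightarrow> (\<forall>X\<in>vector_fields A. \<forall>Y\<in>vector_fields A. \<forall>p.
      along A X \<mu> p *\<^sub>R Y p = along A Y \<mu> p *\<^sub>R X p)" (is "?L \<longleftrightarrow> ?R")
proof
  assume L: ?L
  show ?R
  proof (intro ballI allI)
    fix X Y p assume XY: "X \<in> vector_fields A" "Y \<in> vector_fields A"
    show "along A X \<mu> p *\<^sub>R Y p = along A Y \<mu> p *\<^sub>R X p"
    \<comment> \<open>The Codazzi identity is the vector identity paired with Z; letting Z take
      every value at \<open>p\<close> removes the pairing.\<close>
    proof (rule g_eqI)
      fix u
      obtain Z where Z: "Z \<in> vector_fields A" "Z p = u" using field_through .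
      show "g p (along A X \<mu> p *\<^sub>R Y p) u = g p (along A Y \<mu> p *\<^sub>R X p) u"
        using L[rule_format, OF XY Z(1), of p] codim_nonzero XY Z
        by (simp add: covariant_derivative_ricci g_simps along_def)
    qed
  qed
next
  assume R: ?R
  have "differential A \<mu> p (X p) * g p (Y p) w = differential A \<mu> p (Y p) * g p (X p) w"
    if "X \<in> vector_fields A" "Y \<in> vector_fields A" for X Y p w
    using arg_cong[OF R[rule_format, OF that, of p], of "\<lambda>u. g p u w"]
    by (simp add: g_simps along_def)
  then show ?L by (simp add: covariant_derivative_ricci)
qed

lemma cyclic_ricci_gradient:
  assumes cyclic: "\<forall>X\<in>vector_fields A. \<forall>Y\<in>vector_fields A. \<forall>Z\<in>vector_fields A. \<forall>p.
      covariant_derivative2 A D (ricci A D) X Y Z p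
        + covariant_derivative2 A D (ricci A D) Y Z X p
        + covariant_derivative2 A D (ricci A D) Z X Y p = 0"
  shows "gradient A g \<mu> p = (- 2 * along A V \<mu> p) *\<^sub>R (V p /\<^sub>R on_fields g V V p)"
  unfolding gradient_eq_iff
proof
  fix v
  obtain X where X: "X \<in> vector_fields A" "X p = v" using field_through .
  have pos: "g p (V p) (V p) > 0"
    by (rule g_pos[OF V_nonzero])
  \<comment> \<open>For Y = Z = V the second and third cyclic terms both equal (n - 1) d\<mu>(V)
    g(V,X), whence the factor 2. Solving for d\<mu>(X) means dividing by g(V,V) = |V|^2.\<close>
  have "(real CARD('n) - 1) * (differential A \<mu> p v * g p (V p) (V p)
      + 2 * differential A \<mu> p (V p) * g p (V p) v) = 0"
    using cyclic[rule_format, OF X(1) V_field V_field, of p] X V_field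
    by (simp add: covariant_derivative_ricci g_sym[of p v] algebra_simps)
  then have "differential A \<mu> p v * g p (V p) (V p) = - 2 * differential A \<mu> p (V p) * g p (V p) v"
    using codim_nonzero by simp
  then show "g p ((- 2 * along A V \<mu> p) *\<^sub>R (V p /\<^sub>R on_fields g V V p)) v = differential A \<mu> p v"
    using pos by (simp add: g_simps along_def on_fields_def field_simps)
qed

end

end

theorem proposition2p18:
  fixes A :: "('m::{t2_space, second_countable_topology}, 'n::finite) chart set"
    and g :: "'m \<Rightarrow> real ^ 'n \<Rightarrow> real ^ 'n \<Rightarrow> real"
    and D :: "('m \<Rightarrow> real ^ 'n) \<Rightarrow> ('m \<Rightarrow> real ^ 'n) \<Rightarrow> 'm \<Rightarrow> real ^ 'n"
    and V :: "'m \<Rightarrow> real ^ 'n"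
    and l a :: "'m \<Rightarrow> real"
    and \<theta> :: "'m \<Rightarrow> real ^ 'n \<Rightarrow> real"
  assumes manifold: "smooth_atlas A"
    and dim: "CARD('n) \<ge> 3"
    and metric: "riemannian_metric A g"
    and LC: "levi_civita A g D"
    and soliton: "almost_riemann_soliton A g D V l"
    and a_smooth: "smooth_fun A a"
    and concircular: "\<And>X. X \<in> vector_fields A \<Longrightarrow> D X V = (\<lambda>p. a p *\<^sub>R X p)"
    and theta: "\<And>p v. \<theta> p v = g p v (V p)"
  shows
    "((\<forall>X\<in>vector_fields A. \<forall>Y\<in>vector_fields A. \<forall>Z\<in>vector_fields A. \<forall>p.
         covariant_derivative2 A D (ricci A D) X Y Z p = 0)
      \<longleftrightarrow> (\<forall>p v. differential A l p v = 2 * differential A a p v))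
   \<and> ((\<forall>X\<in>vector_fields A. \<forall>Y\<in>vector_fields A. \<forall>Z\<in>vector_fields A. \<forall>p.
         covariant_derivative2 A D (ricci A D) X Y Z p = \<theta> p (X p) * ricci A D Y Z p)
      \<longleftrightarrow> (\<forall>p. gradient A g (\<lambda>q. l q - 2 * a q) p = (l p - 2 * a p) *\<^sub>R V p))
   \<and> ((\<forall>X\<in>vector_fields A. \<forall>Y\<in>vector_fields A. \<forall>Z\<in>vector_fields A. \<forall>p.
         covariant_derivative2 A D (ricci A D) X Y Z p = covariant_derivative2 A D (ricci A D) Y X Z p)
      \<longleftrightarrow> (\<forall>X\<in>vector_fields A. \<forall>Y\<in>vector_fields A. \<forall>p.
         along A X (\<lambda>q. l q - 2 * a q) p *\<^sub>R Y p = along A Y (\<lambda>q. l q - 2 * a q) p *\<^sub>R X p))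
   \<and> ((\<forall>X\<in>vector_fields A. \<forall>Y\<in>vector_fields A. \<forall>Z\<in>vector_fields A. \<forall>p.
         covariant_derivative2 A D (ricci A D) X Y Z p
           + covariant_derivative2 A D (ricci A D) Y Z X p
           + covariant_derivative2 A D (ricci A D) Z X Y p = 0)
      \<longrightarrow> (\<forall>p. gradient A g (\<lambda>q. l q - 2 * a q) p
              = (- 2 * along A V (\<lambda>q. l q - 2 * a q) p) *\<^sub>R (V p /\<^sub>R on_fields g V V p)))"
proof -
  interpret concircular_soliton A g D V l a
    by unfold_locales (fact manifold metric LC soliton a_smooth concircular)+
  \<comment> \<open>This translates d\<mu> = 0 into d\<lambda> = 2 da for the first claim.\<close>
  have "differential A \<mu> p v = differential A l p v - 2 * differential A a p v" for p v
    unfolding \<mu>_def by (rule differential_linear_combination[OF manifold l_smooth a_smooth])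
  moreover have "\<mu> p = l p - 2 * a p" for p
    by (simp add: \<mu>_def)
  ultimately show ?thesis
    using ricci_symmetric_iff[OF dim] ricci_recurrent_iff[OF dim] ricci_codazzi_iff[OF dim]
      cyclic_ricci_gradient[OF dim]
    unfolding theta \<mu>_def by (intro conjI impI allI) simp_all
qed

end
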